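(* Let $P_{XY}$ be a probability measure defined on $\mathcal{X}\times\mathcal{Y}$ with $|\mathcal{X}|=M<\infty$. Then for all $\alpha\in(0,\infty)$, $$H_{\alpha}(X|Y)\le \log M-d_{\alpha}\bigl(\varepsilon_{X|Y}\,\|\,1-\tfrac1M\bigr).$$ Moreover, let $\mathcal{L}^\ast\colon\mathcal{Y}\to\mathcal{X}$ be a deterministic maximum-a-posteriori decision rule, i.e. $P_{X|Y}(\mathcal{L}^\ast(y)|y)=\max_{x\in\mathcal{X}}P_{X|Y}(x|y)$. The equality $H_{\alpha}(X|Y)=\log M-d_{\alpha}\bigl(\varepsilon_{X|Y}\,\|\,1-\tfrac1M\bigr)$ holds if and only if, for ($P_Y$-almost) all $y\in\mathcal{Y}$, $$P_{X|Y}(x|y)=\begin{cases}\dfrac{\varepsilon_{X|Y}}{M-1}, & x\ne\mathcal{L}^\ast(y),\\[2mm] 1-\varepsilon_{X|Y}, & x=\mathcal{L}^\ast(y).\end{cases}$$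
   Context: Logarithms have an arbitrary fixed base larger than 1 and $\exp$ is the inverse of $\log$. $(X,Y)\sim P_{XY}$, with $\mathcal{X}$ a finite set and $\mathcal{Y}$ an arbitrary observation space. The Arimoto-R\'enyi conditional entropy of order $\alpha\in(0,1)\cup(1,\infty)$ is $$H_\alpha(X|Y)=\frac{\alpha}{1-\alpha}\log\mathbb{E}\left[\Bigl(\sum_{x\in\mathcal{X}}P_{X|Y}^\alpha(x|Y)\Bigr)^{1/\alpha}\right],$$ the expectation being over $Y\sim P_Y$, and $H_1(X|Y)=H(X|Y)$ is the Shannon conditional entropy. The minimum error probability of guessing $X$ from $Y$ is $\varepsilon_{X|Y}=\min_{\mathcal{L}\colon\mathcal{Y}\to\mathcal{X}}\mathbb{P}[X\ne\mathcal{L}(Y)]=1-\mathbb{E}[\max_{x\in\mathcal{X}}P_{X|Y}(x|Y)]$. The binary R\'enyi divergence of order $\alpha\in(0,1)\cup(1,\infty)$ is (with extension by continuity to boundary values) $d_\alpha(p\|q)=\frac{1}{\alpha-1}\log\bigl(p^\alpha q^{1-\alpha}+(1-p)^\alpha(1-q)^{1-\alpha}\bigr)$, and $d_1(p\|q)=p\log\frac pq+(1-p)\log\frac{1-p}{1-q}$; in the degenerate case $M=1$, $d_\alpha(0\|0)=0$. *)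

theory Defs
  imports "HOL-Probability.Probability"
begin

text \<open>
  The joint law is a probability measure \<open>P\<close> on \<open>count_space X \<Otimes>\<^sub>M N\<close>, where \<open>N\<close> is an arbitrary
  measurable space (only \<open>space N\<close> and \<open>sets N\<close> matter).
\<close>

abbreviation marginal_Y :: "'y measure \<Rightarrow> ('x \<times> 'y) measure \<Rightarrow> 'y measure" where
  "marginal_Y N P \<equiv> distr P N snd"

text \<open>
  \<open>K\<close> is a version of the regular conditional distribution of the first component given the second:
  \<open>pmf (K y) x\<close> is the posterior probability of \<open>x\<close> given \<open>y\<close>. Versions agree up to a null set of
  the marginal.
\<close>

definition posterior ::
  "'x set \<Rightarrow> 'y measure \<Rightarrow> ('x \<times> 'y) measure \<Rightarrow> ('y \<Rightarrow> 'x pmf) \<Rightarrow> bool" where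
  "posterior X N P K \<longleftrightarrow>
     (\<forall>y\<in>space N. set_pmf (K y) \<subseteq> X) \<and>
     (\<forall>x\<in>X. (\<lambda>y. pmf (K y) x) \<in> borel_measurable N) \<and>
     (\<forall>x\<in>X. \<forall>B\<in>sets N. measure P ({x} \<times> B) = (\<integral>y\<in>B. pmf (K y) x \<partial>marginal_Y N P))"

lemma posterior_exists:
  fixes P :: "('x \<times> 'y) measure"
  assumes X: "finite X" and P: "prob_space P" "sets P = sets (count_space X \<Otimes>\<^sub>M N)"
  shows "\<exists>K. posterior X N P K"
proof -
  interpret P: prob_space P by fact
  have sp: "space P = X \<times> space N"
    using sets_eq_imp_space_eq[OF P(2)] by (simp add: space_pair_measure)
  have snd_m [measurable]: "snd \<in> P \<rightarrow>\<^sub>M N"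
    using measurable_snd measurable_cong_sets[OF P(2) refl] by blast
  let ?Q = "marginal_Y N P"
  interpret Y: prob_space ?Q by (rule P.prob_space_distr) fact
  obtain x0 where x0: "x0 \<in> X" using P.not_empty sp by auto
  have rect: "{x} \<times> B \<in> sets P" if "x \<in> X" "B \<in> sets N" for x B
    unfolding P(2) using that by auto
  have Q: "measure ?Q B = (\<Sum>x\<in>X. measure P ({x} \<times> B))" if B: "B \<in> sets N" for B
  proof -
    have "measure ?Q B = measure P (snd -` B \<inter> space P)" by (rule measure_distr) (use B in auto)
    also have "snd -` B \<inter> space P = (\<Union>x\<in>X. {x} \<times> B)" using sets.sets_into_space[OF B] sp by auto
    also have "measure P \<dots> = (\<Sum>x\<in>X. measure P ({x} \<times> B))"
      by (rule P.finite_measure_finite_Union) (use X rect B in \<open>auto simp: disjoint_family_on_def\<close>)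
    finally show ?thesis .
  qed
  define R where "R x = distr (restrict_space P ({x} \<times> space N)) N snd" for x
  have Rm: "measure (R x) B = measure P ({x} \<times> B)" "emeasure (R x) B = emeasure P ({x} \<times> B)"
    if "x \<in> X" "B \<in> sets N" for x B
  proof -
    have A: "{x} \<times> space N \<in> sets P" using rect that by auto
    have e: "snd -` B \<inter> ({x} \<times> space N) = {x} \<times> B" using sets.sets_into_space[OF that(2)] by auto
    have m: "snd \<in> restrict_space P ({x} \<times> space N) \<rightarrow>\<^sub>M N" by (rule measurable_restrict_space1) simp
    have "emeasure (R x) B = emeasure (restrict_space P ({x} \<times> space N)) ({x} \<times> B)"
      unfolding R_def
      by (subst emeasure_distr[OF m \<open>B \<in> sets N\<close>])
         (use e sp that in \<open>simp add: space_restrict_space Int_absorb2 Sigma_mono\<close>)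
    also have "\<dots> = emeasure P ({x} \<times> B)"
      by (rule emeasure_restrict_space)
         (use A sets.sets_into_space[OF that(2)] in \<open>auto intro: sets.Int\<close>)
    finally show "emeasure (R x) B = emeasure P ({x} \<times> B)" .
    then show "measure (R x) B = measure P ({x} \<times> B)" by (simp add: measure_def)
  qed
  have Rs [simp]: "sets (R x) = sets N" for x by (simp add: R_def)
  have Rfin: "finite_measure (R x)" if "x \<in> X" for x
    by (rule finite_measureI) (use that in \<open>simp add: Rm(2) sets_eq_imp_space_eq[OF Rs] sets.top P.emeasure_eq_measure\<close>)
  have ac: "absolutely_continuous ?Q (R x)" if x: "x \<in> X" for x
  proof (unfold absolutely_continuous_def, rule subsetI)
    fix B assume "B \<in> null_sets ?Q"
    then have B: "B \<in> sets N" "measure ?Q B = 0" by (auto simp: measure_def null_sets_def)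
    have "measure P ({x} \<times> B) = 0"
      using B(2) unfolding Q[OF B(1)] using X x by (subst (asm) sum_nonneg_eq_0_iff) auto
    then show "B \<in> null_sets (R x)"
      using B x by (auto intro!: null_setsI simp: Rm(2) P.emeasure_eq_measure)
  qed
  have "\<exists>D. D \<in> borel_measurable ?Q \<and> (\<forall>y. 0 \<le> D y) \<and>
      (\<forall>B\<in>sets N. ennreal (measure P ({x} \<times> B)) = (\<integral>\<^sup>+y. ennreal (D y) * indicator B y \<partial>?Q))"
    if x: "x \<in> X" for x
  proof -
    obtain D where D: "D \<in> borel_measurable ?Q" "AE y in ?Q. RN_deriv ?Q (R x) y = ennreal (D y)" "\<And>y. 0 \<le> D y"
      using Y.real_RN_deriv[OF Rfin[OF x] ac[OF x]] by auto
    have "density ?Q (RN_deriv ?Q (R x)) = R x" by (rule Y.density_RN_deriv) (use ac x in auto)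
    then have "emeasure (R x) B = (\<integral>\<^sup>+y. RN_deriv ?Q (R x) y * indicator B y \<partial>?Q)" if "B \<in> sets N" for B
      using that emeasure_density[of "RN_deriv ?Q (R x)" ?Q B] by simp
    moreover have "(\<integral>\<^sup>+y. RN_deriv ?Q (R x) y * indicator B y \<partial>?Q) = (\<integral>\<^sup>+y. ennreal (D y) * indicator B y \<partial>?Q)" for B
      by (rule nn_integral_cong_AE) (use D(2) in auto)
    ultimately show ?thesis using D x by (auto simp: Rm P.emeasure_eq_measure)
  qed
  then have "\<forall>x\<in>X. \<exists>D. D \<in> borel_measurable ?Q \<and> (\<forall>y. 0 \<le> D y) \<and>
      (\<forall>B\<in>sets N. ennreal (measure P ({x} \<times> B)) = (\<integral>\<^sup>+y. ennreal (D y) * indicator B y \<partial>?Q))"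
    by blast
  from bchoice[OF this] obtain D where D': "\<forall>x\<in>X. D x \<in> borel_measurable ?Q \<and> (\<forall>y. 0 \<le> D x y) \<and>
      (\<forall>B\<in>sets N. ennreal (measure P ({x} \<times> B)) = (\<integral>\<^sup>+y. ennreal (D x y) * indicator B y \<partial>?Q))" ..
  have D: "\<And>x. x \<in> X \<Longrightarrow> D x \<in> borel_measurable ?Q" "\<And>x y. x \<in> X \<Longrightarrow> 0 \<le> D x y"
      "\<And>x B. x \<in> X \<Longrightarrow> B \<in> sets N \<Longrightarrow> ennreal (measure P ({x} \<times> B)) = (\<integral>\<^sup>+y. ennreal (D x y) * indicator B y \<partial>?Q)"
    using D' by blast+
  have DN [measurable]: "D x \<in> borel_measurable N" if "x \<in> X" for x using D(1)[OF that] by simp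
  define s where "s y = (\<Sum>x\<in>X. D x y)" for y
  have sm [measurable]: "s \<in> borel_measurable N" unfolding s_def by measurable
  have "density ?Q (\<lambda>y. ennreal (s y)) = density ?Q (\<lambda>_. 1)"
  proof (rule measure_eqI)
    fix B assume "B \<in> sets (density ?Q (\<lambda>y. ennreal (s y)))"
    then have B: "B \<in> sets N" by simp
    have "emeasure (density ?Q (\<lambda>y. ennreal (s y))) B = (\<integral>\<^sup>+y. ennreal (s y) * indicator B y \<partial>?Q)"
      by (rule emeasure_density) (use B in auto)
    also have "\<dots> = (\<integral>\<^sup>+y. (\<Sum>x\<in>X. ennreal (D x y) * indicator B y) \<partial>?Q)"
      by (intro nn_integral_cong) (simp add: s_def D(2) sum_ennreal flip: sum_distrib_right)
    also have "\<dots> = (\<Sum>x\<in>X. \<integral>\<^sup>+y. ennreal (D x y) * indicator B y \<partial>?Q)"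
      by (rule nn_integral_sum) (use B in auto)
    also have "\<dots> = (\<Sum>x\<in>X. ennreal (measure P ({x} \<times> B)))" using D(3)[OF _ B] by simp
    also have "\<dots> = ennreal (measure ?Q B)" by (simp add: Q[OF B])
    also have "\<dots> = emeasure (density ?Q (\<lambda>_. 1)) B" by (simp add: density_1 Y.emeasure_eq_measure)
    finally show "emeasure (density ?Q (\<lambda>y. ennreal (s y))) B = \<dots>" .
  qed simp
  then have "AE y in ?Q. ennreal (s y) = 1"
    by (subst (asm) Y.density_unique_iff) auto
  then have s1: "AE y in ?Q. s y = 1" by auto
  define k where "k y x = (if s y = 1 then (if x \<in> X then D x y else 0) else indicator {x0} x)" for y x
  define K where "K y = embed_pmf (k y)" for y
  have pK: "pmf (K y) x = k y x" for x y
    unfolding K_def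
  proof (rule pmf_embed_pmf)
    show "0 \<le> k y x" for x using D(2) by (simp add: k_def)
    have "(\<integral>\<^sup>+x. ennreal (k y x) \<partial>count_space UNIV) = (\<integral>\<^sup>+x. ennreal (k y x) \<partial>count_space X)"
      using x0 by (intro nn_integral_count_space_eq) (auto simp: k_def indicator_def)
    also have "\<dots> = ennreal (\<Sum>x\<in>X. k y x)"
      using X D(2) by (simp add: nn_integral_count_space_finite k_def)
    also have "(\<Sum>x\<in>X. k y x) = 1"
      using X x0 by (cases "s y = 1") (auto simp: k_def s_def[symmetric] indicator_def)
    finally show "(\<integral>\<^sup>+x. ennreal (k y x) \<partial>count_space UNIV) = 1" by simp
  qed
  have "posterior X N P K"
    unfolding posterior_def
  proof (intro conjI ballI)
    fix y show "set_pmf (K y) \<subseteq> X"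
      using x0 by (auto simp: set_pmf_eq pK k_def indicator_def split: if_splits)
  next
    fix x assume x [simp]: "x \<in> X"
    show "(\<lambda>y. pmf (K y) x) \<in> borel_measurable N" unfolding pK k_def by simp
  next
    fix x B assume x [simp]: "x \<in> X" and B [measurable]: "B \<in> sets N"
    have "(\<integral>y\<in>B. pmf (K y) x \<partial>?Q) = (\<integral>y. D x y * indicator B y \<partial>?Q)"
      unfolding set_lebesgue_integral_def
      by (rule integral_cong_AE) (use s1 in \<open>auto simp: pK k_def\<close>)
    also have "\<dots> = enn2real (\<integral>\<^sup>+y. ennreal (D x y * indicator B y) \<partial>?Q)"
      by (rule integral_eq_nn_integral) (auto simp: D(2))
    also have "(\<integral>\<^sup>+y. ennreal (D x y * indicator B y) \<partial>?Q) = ennreal (measure P ({x} \<times> B))"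
      unfolding D(3)[OF x B] by (intro nn_integral_cong) (auto simp: indicator_def)
    finally show "measure P ({x} \<times> B) = (\<integral>y\<in>B. pmf (K y) x \<partial>?Q)" by simp
  qed
  then show ?thesis by blast
qed

lemma posterior_density:
  fixes P :: "('x \<times> 'y) measure"
  assumes X: "finite X" and P: "prob_space P" "sets P = sets (count_space X \<Otimes>\<^sub>M N)"
    and K: "posterior X N P K"
  shows "P = density (count_space X \<Otimes>\<^sub>M marginal_Y N P) (\<lambda>(x, y). ennreal (pmf (K y) x))"
proof -
  interpret P: prob_space P by fact
  have sp: "space P = X \<times> space N"
    using sets_eq_imp_space_eq[OF P(2)] by (simp add: space_pair_measure)
  have snd_m [measurable]: "snd \<in> P \<rightarrow>\<^sub>M N"
    using measurable_snd measurable_cong_sets[OF P(2) refl] by blast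
  interpret Y: prob_space "marginal_Y N P" by (rule P.prob_space_distr) fact
  have Km: "(\<lambda>y. pmf (K y) x) \<in> borel_measurable (marginal_Y N P)" if "x \<in> X" for x
    using K that by (simp add: posterior_def)
  have fm [measurable]: "(\<lambda>(x, y). ennreal (pmf (K y) x))
      \<in> borel_measurable (count_space X \<Otimes>\<^sub>M marginal_Y N P)"
    unfolding case_prod_beta
    by (rule measurable_compose_countable'[where I = X and g = fst and
        f = "\<lambda>x z. ennreal (pmf (K (snd z)) x)"])
       (use X Km in \<open>auto intro!: measurable_compose[OF measurable_snd] simp: countable_finite\<close>)
  show ?thesis
  proof (rule measure_eqI)
    show "sets P = sets (density (count_space X \<Otimes>\<^sub>M marginal_Y N P) (\<lambda>(x, y). ennreal (pmf (K y) x)))"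
      unfolding sets_density using P(2) by (simp add: sets_pair_measure_cong[OF refl sets_distr])
  next
    fix E assume E: "E \<in> sets P"
    have E1: "E \<in> sets (count_space X \<Otimes>\<^sub>M N)" using E P(2) by simp
    have E2 [measurable]: "E \<in> sets (count_space X \<Otimes>\<^sub>M marginal_Y N P)"
      using E1 by (simp add: sets_pair_measure_cong[OF refl sets_distr])
    have sec: "Pair x -` E \<in> sets N" for x using sets_Pair1[OF E1] .
    have rect: "{x} \<times> Pair x -` E \<in> sets P" if "x \<in> X" for x
      unfolding P(2) using that sec by auto
    have Eeq: "E = (\<Union>x\<in>X. {x} \<times> Pair x -` E)"
      using sets.sets_into_space[OF E] sp by auto
    have "emeasure P E = emeasure P (\<Union>x\<in>X. {x} \<times> Pair x -` E)" using Eeq by simp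
    also have "\<dots> = (\<Sum>x\<in>X. emeasure P ({x} \<times> Pair x -` E))"
      by (rule sum_emeasure[symmetric]) (use rect X in \<open>auto simp: disjoint_family_on_def\<close>)
    also have "\<dots> = (\<Sum>x\<in>X. \<integral>\<^sup>+y. ennreal (pmf (K y) x) * indicator E (x, y) \<partial>marginal_Y N P)"
    proof (rule sum.cong[OF refl])
      fix x assume x: "x \<in> X"
      have "integrable (marginal_Y N P) (\<lambda>y. indicator (Pair x -` E) y *\<^sub>R pmf (K y) x)"
        by (rule Y.integrable_const_bound[where B = 1])
           (use Km[OF x] sec in \<open>auto intro!: borel_measurable_times borel_measurable_indicator
              simp: indicator_times_eq_if pmf_le_1 indicator_le_1 mult_le_one abs_mult\<close>)
      then have "ennreal (\<integral>y. indicator (Pair x -` E) y *\<^sub>R pmf (K y) x \<partial>marginal_Y N P)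
          = (\<integral>\<^sup>+y. ennreal (indicator (Pair x -` E) y *\<^sub>R pmf (K y) x) \<partial>marginal_Y N P)"
        by (intro nn_integral_eq_integral[symmetric]) auto
      moreover have "measure P ({x} \<times> Pair x -` E)
          = (\<integral>y. indicator (Pair x -` E) y *\<^sub>R pmf (K y) x \<partial>marginal_Y N P)"
        using K x sec unfolding posterior_def set_lebesgue_integral_def by blast
      ultimately have "emeasure P ({x} \<times> Pair x -` E)
          = (\<integral>\<^sup>+y. ennreal (indicator (Pair x -` E) y *\<^sub>R pmf (K y) x) \<partial>marginal_Y N P)"
        by (simp add: P.emeasure_eq_measure)
      also have "\<dots> = (\<integral>\<^sup>+y. ennreal (pmf (K y) x) * indicator E (x, y) \<partial>marginal_Y N P)"
        by (intro nn_integral_cong) (auto simp: indicator_def)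
      finally show "emeasure P ({x} \<times> Pair x -` E)
          = (\<integral>\<^sup>+y. ennreal (pmf (K y) x) * indicator E (x, y) \<partial>marginal_Y N P)" .
    qed
    also have "\<dots> = (\<integral>\<^sup>+x. \<integral>\<^sup>+y. ennreal (pmf (K y) x) * indicator E (x, y) \<partial>marginal_Y N P \<partial>count_space X)"
      using X by (simp add: nn_integral_count_space_finite)
    also have "\<dots> = (\<integral>\<^sup>+z. (case z of (x, y) \<Rightarrow> ennreal (pmf (K y) x)) * indicator E z
        \<partial>(count_space X \<Otimes>\<^sub>M marginal_Y N P))"
      using Y.nn_integral_fst[of "\<lambda>z. (case z of (x, y) \<Rightarrow> ennreal (pmf (K y) x)) * indicator E z"
        "count_space X"] by simp
    also have "\<dots> = emeasure (density (count_space X \<Otimes>\<^sub>M marginal_Y N P)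
        (\<lambda>(x, y). ennreal (pmf (K y) x))) E"
      by (rule emeasure_density[symmetric]) auto
    finally show "emeasure P E = \<dots>" .
  qed
qed

definition arimoto_renyi_entropy ::
  "real \<Rightarrow> real \<Rightarrow> 'x set \<Rightarrow> 'y measure \<Rightarrow> ('x \<times> 'y) measure \<Rightarrow> ('y \<Rightarrow> 'x pmf) \<Rightarrow> real" where
  "arimoto_renyi_entropy b \<alpha> X N P K =
     (if \<alpha> = 1
      then \<integral>y. (- (\<Sum>x\<in>X. pmf (K y) x * log b (pmf (K y) x))) \<partial>marginal_Y N P
      else \<alpha> / (1 - \<alpha>) *
           log b (\<integral>y. (\<Sum>x\<in>X. pmf (K y) x powr \<alpha>) powr (1 / \<alpha>) \<partial>marginal_Y N P))"

text \<open>
  At order 1 this is the library's conditional entropy. Its reference measure on the observation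
  space is taken to be the marginal itself, as none is given.
\<close>

lemma arimoto_renyi_entropy_1:
  fixes P :: "('x \<times> 'y) measure"
  assumes b: "b > 1" and X: "finite X"
    and P: "prob_space P" "sets P = sets (count_space X \<Otimes>\<^sub>M N)"
    and K: "posterior X N P K"
  shows "arimoto_renyi_entropy b 1 X N P K =
    prob_space.conditional_entropy P b (count_space X) (marginal_Y N P) fst snd"
proof -
  interpret P: prob_space P by fact
  have snd_m [measurable]: "snd \<in> P \<rightarrow>\<^sub>M N"
    using measurable_snd measurable_cong_sets[OF P(2) refl] by blast
  interpret Y: prob_space "marginal_Y N P" by (rule P.prob_space_distr) fact
  interpret I: information_space P b by unfold_locales (fact b)
  interpret C: finite_measure "count_space X" by (rule finite_measure_count_space) fact
  interpret CY: pair_sigma_finite "count_space X" "marginal_Y N P" ..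
  have Km: "(\<lambda>y. pmf (K y) x) \<in> borel_measurable (marginal_Y N P)" if "x \<in> X" for x
    using K that by (simp add: posterior_def)
  let ?f = "\<lambda>z. pmf (K (snd z)) (fst z)"
  have fm [measurable]: "?f \<in> borel_measurable (count_space X \<Otimes>\<^sub>M marginal_Y N P)"
    by (rule measurable_compose_countable'[where I = X and g = fst and
        f = "\<lambda>x z. pmf (K (snd z)) x"])
       (use X Km in \<open>auto intro!: measurable_compose[OF measurable_snd] simp: countable_finite\<close>)
  have S: "sets P = sets (count_space X \<Otimes>\<^sub>M marginal_Y N P)"
    using P(2) by (simp add: sets_pair_measure_cong[OF refl sets_distr])
  have 1: "distributed P (count_space X \<Otimes>\<^sub>M marginal_Y N P) (\<lambda>x. (fst x, snd x)) (\<lambda>z. ennreal (?f z))"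
    unfolding distributed_def
  proof (intro conjI)
    have "distr P (count_space X \<Otimes>\<^sub>M marginal_Y N P) (\<lambda>x. (fst x, snd x)) = P"
      using distr_id2[OF S[symmetric]] by simp
    also have "\<dots> = density (count_space X \<Otimes>\<^sub>M marginal_Y N P) (\<lambda>z. ennreal (?f z))"
      using posterior_density[OF X P K] by (simp add: case_prod_beta')
    finally show "distr P (count_space X \<Otimes>\<^sub>M marginal_Y N P) (\<lambda>x. (fst x, snd x)) = \<dots>" .
    show "(\<lambda>x. (fst x, snd x)) \<in> P \<rightarrow>\<^sub>M count_space X \<Otimes>\<^sub>M marginal_Y N P"
      using measurable_ident_sets[OF S] by simp
  qed auto
  have 2: "distributed P (marginal_Y N P) snd (\<lambda>y. ennreal ((\<lambda>_. 1) y))"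
  proof -
    have "distr P (marginal_Y N P) snd = marginal_Y N P" by (rule distr_cong) auto
    then show ?thesis by (simp add: distributed_def density_1)
  qed
  have "P.conditional_entropy b (count_space X) (marginal_Y N P) fst snd =
     - (\<integral>(x, y). ?f (x, y) * log b (?f (x, y) / 1) \<partial>(count_space X \<Otimes>\<^sub>M marginal_Y N P))"
    by (rule I.conditional_entropy_generic_eq[OF C.sigma_finite_measure_axioms Y.sigma_finite_measure_axioms 2 _ 1]) auto
  also have "(\<integral>(x, y). ?f (x, y) * log b (?f (x, y) / 1) \<partial>(count_space X \<Otimes>\<^sub>M marginal_Y N P))
     = (\<integral>z. ?f z * log b (?f z) \<partial>(count_space X \<Otimes>\<^sub>M marginal_Y N P))"
    by (simp add: case_prod_beta')
  also have "\<dots> = (\<integral>y. \<integral>x. pmf (K y) x * log b (pmf (K y) x) \<partial>count_space X \<partial>marginal_Y N P)"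
  proof -
    have fin: "finite_measure (count_space X \<Otimes>\<^sub>M marginal_Y N P)"
      by (rule finite_measure_pair_measure) unfold_locales
    have bd: "norm (t * log b t) \<le> 1 / ln b" if "0 \<le> t" "t \<le> 1" for t :: real
    proof (cases "t = 0")
      case True then show ?thesis using b by simp
    next
      case False
      then have t: "t > 0" using that by simp
      have "ln (1 / t) \<le> 1 / t - 1" by (rule ln_le_minus_one) (use t in auto)
      then have "t * ln (1 / t) \<le> 1 - t" using t by (simp add: field_simps)
      then have "- (t * ln t) \<le> 1" using t by (simp add: ln_div)
      moreover have "t * ln t \<le> 0" using t that by (simp add: mult_nonneg_nonpos)
      ultimately show ?thesis using b by (simp add: log_def divide_simps abs_mult)
    qed
    have "integrable (count_space X \<Otimes>\<^sub>M marginal_Y N P) (\<lambda>(x, y). pmf (K y) x * log b (pmf (K y) x))"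
      unfolding case_prod_beta'
      by (rule finite_measure.integrable_const_bound[OF fin, where B = "1 / ln b"])
         (auto intro!: AE_I2 bd simp del: real_norm_def simp: pmf_le_1)
    from CY.integral_snd[OF this] show ?thesis by (simp add: case_prod_beta')
  qed
  finally show ?thesis
    using X by (simp add: arimoto_renyi_entropy_def lebesgue_integral_count_space_finite)
qed

text \<open>Decision rules are measurable, so that the error event is an event.\<close>

definition min_error_prob :: "'x set \<Rightarrow> 'y measure \<Rightarrow> ('x \<times> 'y) measure \<Rightarrow> real" where
  "min_error_prob X N P =
     (INF L \<in> N \<rightarrow>\<^sub>M count_space X. measure P {z \<in> space P. fst z \<noteq> L (snd z)})"

definition MAP_rule :: "'x set \<Rightarrow> 'y measure \<Rightarrow> ('y \<Rightarrow> 'x pmf) \<Rightarrow> ('y \<Rightarrow> 'x) \<Rightarrow> bool" where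
  "MAP_rule X N K L \<longleftrightarrow>
     (\<forall>y\<in>space N. L y \<in> X \<and> pmf (K y) (L y) = Max ((\<lambda>x. pmf (K y) x) ` X))"

text \<open>
  The value is \<open>\<infinity>\<close> at the boundary points of the unit square where the divergence diverges.
  At the remaining boundary points the conventions \<open>0 powr a = 0\<close> and \<open>x / 0 = 0\<close> give the
  right value. For \<open>\<alpha> \<ge> 1\<close> there is no joint limit at \<open>p = q = 0\<close> and \<open>p = q = 1\<close>, where the
  value is \<open>0\<close> by convention.
\<close>

definition binary_renyi_div :: "real \<Rightarrow> real \<Rightarrow> real \<Rightarrow> real \<Rightarrow> ereal" where
  "binary_renyi_div b \<alpha> p q =
     (if \<alpha> < 1 \<and> (p = 0 \<and> q = 1 \<or> p = 1 \<and> q = 0) \<or>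
         \<alpha> \<ge> 1 \<and> (p \<noteq> 0 \<and> q = 0 \<or> p \<noteq> 1 \<and> q = 1)
      then \<infinity>
      else if \<alpha> = 1
      then ereal (p * log b (p / q) + (1 - p) * log b ((1 - p) / (1 - q)))
      else ereal (1 / (\<alpha> - 1) *
             log b (p powr \<alpha> * q powr (1 - \<alpha>) + (1 - p) powr \<alpha> * (1 - q) powr (1 - \<alpha>))))"

end

theory Submission
  imports Defs
begin

text \<open>
  Compare the posterior at \<open>y\<close> with the distribution that gives the MAP guess the mass \<open>1 - \<epsilon>\<close> and
  spreads \<open>\<epsilon>\<close> evenly over the remaining values. H\<ouml>lder's inequality (Gibbs' inequality for
  \<open>\<alpha> = 1\<close>) bounds the \<open>\<alpha>\<close>-norm (the entropy) of the posterior by a linear functional that depends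
  on the posterior only through its maximum, whose expectation is \<open>1 - \<epsilon>\<close>. Integrating over \<open>y\<close>
  gives the bound without a separate appeal to Jensen's inequality, and equality forces equality in
  H\<ouml>lder's inequality almost everywhere. For \<open>\<epsilon> = 0\<close>, where the comparison distribution lacks full
  support, the posterior is a point mass almost everywhere and equality holds.
\<close>

section \<open>Tangent inequalities for powers, and the Hoelder and Gibbs gaps\<close>

text \<open>The power function is strictly convex for \<open>a > 1\<close> and strictly concave for
  \<open>a < 1\<close>, so its graph meets the tangent at 1 only there. Dividing by
  \<open>a - 1\<close> turns both cases into one inequality. The mean value theorem is applied
  between \<open>t\<close> and 1; \<open>t = 0\<close> is split off because the derivative is only
  taken at positive points.\<close>

lemma powr_Bernoulli_strict:
  fixes a t :: real
  assumes a: "a > 0" "a \<noteq> 1" and t: "t \<ge> 0" "t \<noteq> 1"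
  shows "(t powr a - 1 - a * (t - 1)) / (a - 1) > 0"
proof (cases "t = 0")
  case True
  then show ?thesis using a by simp
next
  case False
  with t have t0: "t > 0" by simp
  have der: "((\<lambda>x. x powr a) has_real_derivative a * x powr (a - 1)) (at x)" if "x > 0" for x
    using that by (auto intro!: derivative_eq_intros)
  consider "t < 1" | "t > 1" using t by linarith
  then show ?thesis
  proof cases
    case 1
    obtain z where z: "t < z" "z < 1" "1 powr a - t powr a = (1 - t) * (a * z powr (a - 1))"
      using MVT2[of t 1 "\<lambda>x. x powr a" "\<lambda>x. a * x powr (a - 1)"] 1 t0 der by auto
    have "t powr a - 1 - a * (t - 1) = a * (1 - t) * (1 - z powr (a - 1))"
      using z(3) by (simp add: algebra_simps)
    moreover have "(1 - z powr (a - 1)) / (a - 1) > 0"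
    proof (cases "a > 1")
      case True
      then have "z powr (a - 1) < 1" using z t0 powr_less_mono2[of "a - 1" z 1] by auto
      then show ?thesis using True by simp
    next
      case False
      then have "1 < z powr (a - 1)" using z t0 a powr_less_mono2_neg[of "a - 1" z 1] by auto
      then show ?thesis using False a by (intro divide_neg_neg) auto
    qed
    ultimately show ?thesis
      using mult_pos_pos[of "a * (1 - t)" "(1 - z powr (a - 1)) / (a - 1)"] a 1 by simp
  next
    case 2
    obtain z where z: "1 < z" "z < t" "t powr a - 1 powr a = (t - 1) * (a * z powr (a - 1))"
      using MVT2[of 1 t "\<lambda>x. x powr a" "\<lambda>x. a * x powr (a - 1)"] 2 der by auto
    have "t powr a - 1 - a * (t - 1) = a * (t - 1) * (z powr (a - 1) - 1)"
      using z(3) by (simp add: algebra_simps)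
    moreover have "(z powr (a - 1) - 1) / (a - 1) > 0"
    proof (cases "a > 1")
      case True
      then have "z powr (a - 1) > 1" using z by (intro gr_one_powr) auto
      then show ?thesis using True by simp
    next
      case False
      then have "z powr (a - 1) < 1" using z a powr_less_mono2_neg[of "a - 1" 1 z] by auto
      then show ?thesis using False a by (intro divide_neg_neg) auto
    qed
    ultimately show ?thesis
      using mult_pos_pos[of "a * (t - 1)" "(z powr (a - 1) - 1) / (a - 1)"] a 2 by simp
  qed
qed

text \<open>Both sides are homogeneous of degree \<open>a\<close>: scaling by
  \<open>v powr a\<close> moves the point of tangency from 1 to \<open>v\<close>.\<close>

lemma powr_tangent_strict:
  fixes a u v :: real
  assumes a: "a > 0" "a \<noteq> 1" and u: "u \<ge> 0" and v: "v > 0" and "u \<noteq> v"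
  shows "(u powr a - v powr a - a * (u * v powr (a - 1) - v powr a)) / (a - 1) > 0"
proof -
  have "v powr a * (((u / v) powr a - 1 - a * (u / v - 1)) / (a - 1)) > 0"
    using assms by (intro mult_pos_pos powr_Bernoulli_strict) auto
  also have "v powr a * (((u / v) powr a - 1 - a * (u / v - 1)) / (a - 1))
      = (u powr a - v powr a - a * (u * v powr (a - 1) - v powr a)) / (a - 1)"
  proof -
    have "(u / v) powr a * v powr a = u powr a" and "v powr (a - 1) = v powr a / v"
      using u v by (simp_all add: powr_divide powr_diff)
    then show ?thesis by (simp add: algebra_simps)
  qed
  finally show ?thesis .
qed

text \<open>
  H\<ouml>lder's inequality for \<open>a > 1\<close> and the reverse H\<ouml>lder inequality for \<open>a < 1\<close>; dividing by
  \<open>a - 1\<close> gives both the same sign.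
\<close>

lemma Hoelder_gap:
  fixes p q :: "'a \<Rightarrow> real" and a :: real
  assumes X: "finite X" and a: "a > 0" "a \<noteq> 1"
    and p: "\<And>x. x \<in> X \<Longrightarrow> p x \<ge> 0" "(\<Sum>x\<in>X. p x) = 1"
    and q: "\<And>x. x \<in> X \<Longrightarrow> q x > 0" "(\<Sum>x\<in>X. q x) = 1"
  defines "S \<equiv> \<Sum>x\<in>X. q x powr a"
  defines "D \<equiv> ((\<Sum>x\<in>X. p x powr a) powr (1 / a)
      - S powr (1 / a - 1) * (\<Sum>x\<in>X. p x * q x powr (a - 1))) / (a - 1)"
  shows "D \<ge> 0" and "D = 0 \<Longrightarrow> x \<in> X \<Longrightarrow> p x = q x"
proof -
  define T where "T = (\<Sum>x\<in>X. p x powr a)"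
  \<comment> \<open>The factor \<open>r\<close> rescales \<open>p\<close> to the same
    \<open>a\<close>-norm as \<open>q\<close>, so that the pure power terms cancel when the tangent
    inequalities at \<open>u = r * p x\<close>, \<open>v = q x\<close> are summed.\<close>
  define r where "r = (S / T) powr (1 / a)"
  define W where "W = (\<Sum>x\<in>X. p x * q x powr (a - 1))"
  define g where "g x = ((r * p x) powr a - q x powr a
      - a * ((r * p x) * q x powr (a - 1) - q x powr a)) / (a - 1)" for x
  have "X \<noteq> {}" using p(2) by auto
  then have S: "S > 0" unfolding S_def using X q(1) by (intro sum_pos) (auto, force)
  obtain x0 where x0: "x0 \<in> X" "p x0 \<noteq> 0"
    using p(2) by (metis sum.neutral zero_neq_one)
  then have "p x0 powr a > 0" by simp
  then have T: "T > 0" unfolding T_def using X x0(1) by (intro sum_pos2) auto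
  have r: "r > 0" using S T by (simp add: r_def)
  have ra: "r powr a = S / T" using S T a by (simp add: r_def powr_powr)
  have g0: "g x \<ge> 0" "g x = 0 \<Longrightarrow> r * p x = q x" if "x \<in> X" for x
    using powr_tangent_strict[OF a, of "r * p x" "q x"] p(1)[OF that] q(1)[OF that] r
    by (cases "r * p x = q x"; force simp: g_def powr_diff)+
  have "(\<Sum>x\<in>X. g x) = (r powr a * T - S - a * (r * W - S)) / (a - 1)"
    using p r by (simp add: g_def T_def S_def W_def sum_subtractf sum.distrib sum_distrib_left powr_mult
        algebra_simps flip: sum_divide_distrib)
  also have "\<dots> = a * (S - r * W) / (a - 1)" using T by (simp add: ra algebra_simps)
  finally have sg: "(\<Sum>x\<in>X. g x) = a * (S - r * W) / (a - 1)" .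
  have "r * T powr (1 / a) = S powr (1 / a)" using S T by (simp add: r_def powr_divide)
  then have "r * D = (S powr (1 / a) - S powr (1 / a - 1) * (r * W)) / (a - 1)"
    by (simp add: D_def T_def[symmetric] W_def[symmetric] algebra_simps)
  also have "S powr (1 / a) = S powr (1 / a - 1) * S"
    using S powr_add[of S "1 / a - 1" 1] by simp
  finally have "r * D = S powr (1 / a - 1) * (S - r * W) / (a - 1)"
    by (simp add: algebra_simps)
  then have "a * (r * D) = a * (S powr (1 / a - 1) * (S - r * W) / (a - 1))" by (rule arg_cong)
  \<comment> \<open>Up to positive factors \<open>D\<close> is the sum of the pointwise gaps; its
    sign and the case \<open>D = 0\<close> can be read off from the \<open>g x\<close>.\<close>
  then have rD: "a * r * D = S powr (1 / a - 1) * (\<Sum>x\<in>X. g x)"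
    by (simp add: sg ac_simps)
  have "a * r * D \<ge> 0" unfolding rD using g0 by (intro mult_nonneg_nonneg sum_nonneg) auto
  then show "D \<ge> 0" using a r by (simp add: mult.assoc zero_le_mult_iff)
  assume "D = 0" and x: "x \<in> X"
  then have "(\<Sum>x\<in>X. g x) = 0" using rD S by simp
  then have eq: "r * p x = q x" if "x \<in> X" for x
    using g0 X that by (subst (asm) sum_nonneg_eq_0_iff) auto
  \<comment> \<open>Equality gives only proportionality of \<open>p\<close> and \<open>q\<close>;
    since both sum to 1, the factor is 1.\<close>
  have "r = (\<Sum>x\<in>X. r * p x)" using p(2) by (simp flip: sum_distrib_left)
  then have "r = 1" using eq q(2) by simp
  then show "p x = q x" using eq[OF x] by simp
qed

text \<open>The estimate \<open>ln t \<le> t - 1\<close> at \<open>t = q x / p x\<close> makes each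
  \<open>g x\<close> nonnegative, with equality only for \<open>t = 1\<close>. The correction
  \<open>p x - q x\<close> in \<open>g\<close> sums to 0. Where \<open>p x = 0\<close>, the gap is
  \<open>q x > 0\<close>.\<close>

lemma Gibbs_gap:
  fixes p q :: "'a \<Rightarrow> real"
  assumes b: "b > 1" and X: "finite X"
    and p: "\<And>x. x \<in> X \<Longrightarrow> p x \<ge> 0" "(\<Sum>x\<in>X. p x) = 1"
    and q: "\<And>x. x \<in> X \<Longrightarrow> q x > 0" "(\<Sum>x\<in>X. q x) = 1"
  defines "D \<equiv> (\<Sum>x\<in>X. p x * log b (p x)) - (\<Sum>x\<in>X. p x * log b (q x))"
  shows "D \<ge> 0" and "D = 0 \<Longrightarrow> x \<in> X \<Longrightarrow> p x = q x"
proof -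
  define g where "g x = p x * ln (p x) - p x * ln (q x) - (p x - q x)" for x
  have g0: "g x \<ge> 0 \<and> (g x = 0 \<longrightarrow> p x = q x)" if "x \<in> X" for x
  proof (cases "p x = 0")
    case True
    then show ?thesis using q(1)[OF that] by (simp add: g_def)
  next
    case False
    with p(1)[OF that] have px: "p x > 0" by simp
    have qx: "q x > 0" using q(1)[OF that] .
    have g: "g x = p x * (q x / p x - 1 - ln (q x / p x))"
      using px qx by (simp add: g_def ln_div field_simps)
    have "ln (q x / p x) \<le> q x / p x - 1" by (rule ln_le_minus_one) (use px qx in simp)
    moreover have "q x / p x = 1" if "ln (q x / p x) = q x / p x - 1"
      by (rule ln_eq_minus_one) (use px qx that in simp_all)
    ultimately show ?thesis using px unfolding g by auto
  qed
  have "(\<Sum>x\<in>X. g x) = (\<Sum>x\<in>X. p x * ln (p x)) - (\<Sum>x\<in>X. p x * ln (q x))"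
    using p(2) q(2) by (simp add: g_def sum_subtractf)
  then have D: "D = (\<Sum>x\<in>X. g x) / ln b"
    by (simp add: D_def log_def diff_divide_distrib sum_divide_distrib)
  show "D \<ge> 0" unfolding D using g0 b by (intro divide_nonneg_nonneg sum_nonneg) auto
  assume "D = 0" and x: "x \<in> X"
  then have "(\<Sum>x\<in>X. g x) = 0" using D b by simp
  then have "\<forall>x\<in>X. g x = 0" using g0 X by (subst (asm) sum_nonneg_eq_0_iff) auto
  then show "p x = q x" using g0 x by blast
qed

section \<open>The right-hand side of the bound as an entropy\<close>

lemma log_minus_binary_renyi_div:
  fixes b \<alpha> e :: real and M :: nat
  assumes b: "b > 1" and \<alpha>: "\<alpha> > 0" and M: "M \<ge> 1" and e: "0 \<le> e" "e \<le> 1 - 1 / M"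
  shows "ereal (log b M) - binary_renyi_div b \<alpha> e (1 - 1 / M) =
    ereal (if \<alpha> = 1
      then - ((1 - e) * log b (1 - e) + (real M - 1) * (e / (real M - 1) * log b (e / (real M - 1))))
      else 1 / (1 - \<alpha>) * log b ((1 - e) powr \<alpha> + (real M - 1) * (e / (real M - 1)) powr \<alpha>))"
proof (cases "M = 1")
  case True
  \<comment> \<open>Here \<open>e = 0\<close>, and the default value of \<open>e / 0\<close> is
    harmless because it is multiplied by \<open>real M - 1 = 0\<close>.\<close>
  then show ?thesis using e by (simp add: binary_renyi_div_def)
next
  case False
  with M have M2: "M \<ge> 2" by simp
  define m where "m = real M"
  have m: "m \<ge> 2" using M2 by (simp add: m_def)
  have q: "1 - 1 / m = (m - 1) / m" using m by (simp add: field_simps)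
  have e1: "e < 1" using e m unfolding m_def[symmetric] by (smt (verit) divide_pos_pos)
  \<comment> \<open>The second argument lies off the boundary, so the infinite branch of
    \<open>binary_renyi_div\<close> is excluded.\<close>
  have fin: "1 - 1 / m \<noteq> 0" "1 - 1 / m \<noteq> 1" using m by (auto simp: field_simps)
  show ?thesis
  proof (cases "\<alpha> = 1")
    case True
    have "e * log b (e / ((m - 1) / m)) = e * log b (e / (m - 1)) + e * log b m"
    proof (cases "e = 0")
      case False
      then have "e / (m - 1) > 0" using e m by simp
      then have "log b (e / (m - 1) * m) = log b (e / (m - 1)) + log b m"
        using m by (intro log_mult_pos) auto
      then show ?thesis by (simp add: algebra_simps)
    qed simp
    moreover have "log b ((1 - e) * m) = log b (1 - e) + log b m"
      using m e1 by (intro log_mult_pos) auto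
    moreover have "(1 - e) / (1 - (m - 1) / m) = (1 - e) * m" using m by (simp add: field_simps)
    moreover have "(m - 1) * (e / (m - 1) * log b (e / (m - 1))) = e * log b (e / (m - 1))"
      using m by simp
    moreover have "binary_renyi_div b \<alpha> e (1 - 1 / m) = ereal (e * log b (e / ((m - 1) / m))
        + (1 - e) * log b ((1 - e) / (1 - (m - 1) / m)))"
      using fin unfolding binary_renyi_div_def True q by simp
    ultimately show ?thesis
      unfolding True m_def[symmetric] by (simp only: if_True refl) (simp add: algebra_simps)
  next
    case False
    define S where "S = (1 - e) powr \<alpha> + (m - 1) * (e / (m - 1)) powr \<alpha>"
    have S: "S > 0" unfolding S_def using e1 m by (intro add_pos_nonneg mult_nonneg_nonneg) auto
    \<comment> \<open>The uniform mass \<open>1 / m\<close> contributes the same factor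
      \<open>m powr (\<alpha> - 1)\<close> to both summands; after taking logarithms it yields the
      term \<open>log b m\<close>.\<close>
    have "e powr \<alpha> * ((m - 1) / m) powr (1 - \<alpha>) + (1 - e) powr \<alpha> * (1 - (m - 1) / m) powr (1 - \<alpha>)
      = m powr (\<alpha> - 1) * S"
    proof -
      have "1 - (m - 1) / m = 1 / m" using m by (simp add: field_simps)
      moreover have "(1 / m) powr (1 - \<alpha>) = m powr (\<alpha> - 1)"
        using m by (simp add: powr_divide powr_diff)
      moreover have "((m - 1) / m) powr (1 - \<alpha>) = (m - 1) powr (1 - \<alpha>) * m powr (\<alpha> - 1)"
        using m by (simp add: powr_divide powr_diff)
      moreover have "(m - 1) * (e / (m - 1)) powr \<alpha> = e powr \<alpha> * (m - 1) powr (1 - \<alpha>)"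
        using m e by (simp add: powr_divide powr_diff)
      ultimately show ?thesis by (simp only: S_def) (simp add: algebra_simps)
    qed
    moreover have "log b (m powr (\<alpha> - 1) * S) = (\<alpha> - 1) * log b m + log b S"
      using S m by (simp add: log_mult_pos log_powr)
    ultimately have d: "binary_renyi_div b \<alpha> e (1 - 1 / m)
        = ereal (1 / (\<alpha> - 1) * ((\<alpha> - 1) * log b m + log b S))"
      using False fin unfolding binary_renyi_div_def q by simp
    have "log b m - 1 / (\<alpha> - 1) * ((\<alpha> - 1) * log b m + log b S) = 1 / (1 - \<alpha>) * log b S"
      using False by (simp add: field_simps)
    then show ?thesis
      using False d unfolding S_def m_def by simp
  qed
qed

text \<open>A nonnegative difference with zero integral vanishes almost everywhere. This carries
  equality of expectations back to the individual observations.\<close>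

lemma (in prob_space) integral_eq_imp_AE_eq:
  fixes f g :: "'a \<Rightarrow> real"
  assumes fg: "integrable M f" "integrable M g" and le: "AE x in M. f x \<le> g x"
    and eq: "integral\<^sup>L M f = integral\<^sup>L M g"
  shows "AE x in M. f x = g x"
proof -
  have "AE x in M. g x - f x = 0"
    using fg le eq integral_nonneg_eq_0_iff_AE[of M "\<lambda>x. g x - f x"] by simp
  then show ?thesis by eventually_elim simp
qed

section \<open>Posterior maxima and the minimum error probability\<close>

locale finite_guessing =
  fixes X :: "'x set" and N :: "'y measure" and P :: "('x \<times> 'y) measure" and K :: "'y \<Rightarrow> 'x pmf"
  assumes X: "finite X"
    and P: "prob_space P" "sets P = sets (count_space X \<Otimes>\<^sub>M N)"
    and K: "posterior X N P K"
begin

abbreviation "Q \<equiv> marginal_Y N P"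

definition max_post :: "'y \<Rightarrow> real" where
  "max_post y = Max ((\<lambda>x. pmf (K y) x) ` X)"

lemma space_P: "space P = X \<times> space N"
  using sets_eq_imp_space_eq[OF P(2)] by (simp add: space_pair_measure)

lemma snd_measurable [measurable]: "snd \<in> P \<rightarrow>\<^sub>M N"
  using measurable_snd measurable_cong_sets[OF P(2) refl] by blast

sublocale P: prob_space P by (rule P)

sublocale Y: prob_space Q by (rule P.prob_space_distr) (rule snd_measurable)

lemma X_nonempty: "X \<noteq> {}"
  using P.not_empty space_P by auto

lemma posterior_measurable [measurable]: "x \<in> X \<Longrightarrow> (\<lambda>y. pmf (K y) x) \<in> borel_measurable N"
  using K by (simp add: posterior_def)

lemma sum_posterior: "y \<in> space N \<Longrightarrow> (\<Sum>x\<in>X. pmf (K y) x) = 1"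
  using K X by (intro sum_pmf_eq_1) (auto simp: posterior_def)

lemma max_post_measurable [measurable]: "max_post \<in> borel_measurable N"
  unfolding max_post_def using X by (intro borel_measurable_Max) auto

lemma pmf_le_max_post: "x \<in> X \<Longrightarrow> pmf (K y) x \<le> max_post y"
  unfolding max_post_def using X by (intro Max_ge) auto

lemma max_post_attained: "\<exists>x\<in>X. pmf (K y) x = max_post y"
proof -
  have "max_post y \<in> (\<lambda>x. pmf (K y) x) ` X"
    unfolding max_post_def using X X_nonempty by (intro Max_in) auto
  then show ?thesis by force
qed

lemma max_post_bounds: "0 \<le> max_post y" "max_post y \<le> 1"
  using max_post_attained[of y] pmf_le_1 by (metis pmf_nonneg, metis)

lemma max_post_ge: "y \<in> space N \<Longrightarrow> 1 / card X \<le> max_post y"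
proof -
  assume "y \<in> space N"
  then have "1 \<le> card X * max_post y"
    using sum_bounded_above[of X "\<lambda>x. pmf (K y) x" "max_post y"] pmf_le_max_post
    by (simp add: sum_posterior)
  moreover have "card X > 0" using X X_nonempty by (simp add: card_gt_0_iff)
  ultimately show ?thesis by (simp add: field_simps)
qed

lemma integrable_max_post: "integrable Q max_post"
  by (rule Y.integrable_const_bound[where B = 1]) (use max_post_bounds in auto)

text \<open>Ties have to be broken measurably: enumerate \<open>X\<close> by \<open>g\<close> and
  take the least index at which the posterior attains its maximum.\<close>

lemma measurable_MAP_rule_exists: "\<exists>L \<in> N \<rightarrow>\<^sub>M count_space X. MAP_rule X N K L"
proof -
  obtain g where g: "bij_betw g {..<card X} X"
    using ex_bij_betw_nat_finite[OF X] by (auto simp: atLeast0LessThan)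
  define I where "I y = (LEAST i. i < card X \<and> pmf (K y) (g i) = max_post y)" for y
  have I: "I y < card X \<and> pmf (K y) (g (I y)) = max_post y" for y
  proof -
    obtain x where x: "x \<in> X" "pmf (K y) x = max_post y" using max_post_attained by blast
    moreover have "x \<in> g ` {..<card X}" using g x(1) by (simp add: bij_betw_def)
    then obtain i where "i < card X" "g i = x" by auto
    then have "\<exists>i. i < card X \<and> pmf (K y) (g i) = max_post y" using x by auto
    then show ?thesis unfolding I_def by (rule LeastI_ex)
  qed
  have gX: "g i \<in> X" if "i < card X" for i using g that by (auto simp: bij_betw_def)
  have "Measurable.pred N (\<lambda>y. i < card X \<and> pmf (K y) (g i) = max_post y)" for i
    using gX[of i] by (cases "i < card X") auto
  then have Im: "I \<in> N \<rightarrow>\<^sub>M count_space UNIV"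
    unfolding I_def[abs_def] by (rule measurable_Least)
  have "(\<lambda>y. g (I y)) \<in> N \<rightarrow>\<^sub>M count_space X"
  proof (rule measurableI)
    fix A
    have "(\<lambda>y. g (I y)) -` A \<inter> space N = I -` (g -` A) \<inter> space N" by auto
    also have "\<dots> \<in> sets N" by (rule measurable_sets[OF Im]) auto
    finally show "(\<lambda>y. g (I y)) -` A \<inter> space N \<in> sets N" .
  qed (use gX I in auto)
  moreover have "MAP_rule X N K (\<lambda>y. g (I y))"
    using I gX by (auto simp: MAP_rule_def max_post_def)
  ultimately show ?thesis by blast
qed

text \<open>The sets \<open>B x\<close> of observations on which \<open>L\<close> guesses
  \<open>x\<close> partition \<open>space N\<close>. On each rectangle
  \<open>{x} \<times> B x\<close> the probability of a correct guess is an integral of the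
  posterior, by the definition of \<open>posterior\<close>.\<close>

lemma error_prob:
  assumes L [measurable]: "L \<in> N \<rightarrow>\<^sub>M count_space X"
  shows "integrable Q (\<lambda>y. pmf (K y) (L y))"
    and "measure P {z \<in> space P. fst z \<noteq> L (snd z)} = 1 - (\<integral>y. pmf (K y) (L y) \<partial>Q)"
proof -
  define B where "B x = L -` {x} \<inter> space N" for x
  have B [measurable]: "B x \<in> sets N" if "x \<in> X" for x
    unfolding B_def using that by (intro measurable_sets[OF L]) auto
  \<comment> \<open>Written as a finite sum over the fixed values \<open>x\<close>, the posterior at
    the varying point \<open>L y\<close> is seen to be measurable and integrable.\<close>
  have eq: "pmf (K y) (L y) = (\<Sum>x\<in>X. indicator (B x) y * pmf (K y) x)" if "y \<in> space N" for y
  proof -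
    have "L y \<in> X" using measurable_space[OF L that] by simp
    then have "(\<Sum>x\<in>X. if x = L y then pmf (K y) x else 0) = pmf (K y) (L y)" using X by simp
    also have "(\<Sum>x\<in>X. if x = L y then pmf (K y) x else 0)
        = (\<Sum>x\<in>X. indicator (B x) y * pmf (K y) x)"
      using that by (intro sum.cong) (auto simp: B_def)
    finally show ?thesis by simp
  qed
  have int: "integrable Q (\<lambda>y. indicator (B x) y * pmf (K y) x)" if "x \<in> X" for x
    using that by (intro Y.integrable_const_bound[where B = 1])
      (auto simp: indicator_def pmf_le_1)
  have "integrable Q (\<lambda>y. \<Sum>x\<in>X. indicator (B x) y * pmf (K y) x)" using int by auto
  then show "integrable Q (\<lambda>y. pmf (K y) (L y))"
    by (subst Bochner_Integration.integrable_cong[OF refl eq]) auto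
  have rect: "{x} \<times> B x \<in> sets P" if "x \<in> X" for x
    unfolding P(2) using that by auto
  have set: "{z \<in> space P. fst z = L (snd z)} = (\<Union>x\<in>X. {x} \<times> B x)"
    unfolding space_P B_def by auto
  have "measure P {z \<in> space P. fst z = L (snd z)} = (\<Sum>x\<in>X. measure P ({x} \<times> B x))"
    unfolding set using X rect
    by (intro P.finite_measure_finite_Union) (auto simp: disjoint_family_on_def)
  also have "\<dots> = (\<Sum>x\<in>X. \<integral>y. indicator (B x) y * pmf (K y) x \<partial>Q)"
    using K B by (intro sum.cong) (auto simp: posterior_def set_lebesgue_integral_def)
  also have "\<dots> = (\<integral>y. (\<Sum>x\<in>X. indicator (B x) y * pmf (K y) x) \<partial>Q)"
    using int by simp
  also have "\<dots> = (\<integral>y. pmf (K y) (L y) \<partial>Q)"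
    using eq by (intro Bochner_Integration.integral_cong) auto
  finally have 1: "measure P {z \<in> space P. fst z = L (snd z)} = (\<integral>y. pmf (K y) (L y) \<partial>Q)" .
  have "{z \<in> space P. fst z = L (snd z)} \<in> P.events"
    unfolding set using X rect by auto
  moreover have "{z \<in> space P. fst z \<noteq> L (snd z)} = space P - {z \<in> space P. fst z = L (snd z)}"
    by auto
  ultimately show "measure P {z \<in> space P. fst z \<noteq> L (snd z)} = 1 - (\<integral>y. pmf (K y) (L y) \<partial>Q)"
    using 1 P.prob_compl by presburger
qed

text \<open>No rule beats the pointwise posterior maximum, and a measurable MAP rule attains it; the
  infimum is therefore a minimum.\<close>

lemma min_error_prob_eq: "min_error_prob X N P = 1 - (\<integral>y. max_post y \<partial>Q)"
  unfolding min_error_prob_def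
proof (rule cInf_eq_minimum)
  obtain L where L: "L \<in> N \<rightarrow>\<^sub>M count_space X" "MAP_rule X N K L"
    using measurable_MAP_rule_exists by blast
  have "(\<integral>y. max_post y \<partial>Q) = (\<integral>y. pmf (K y) (L y) \<partial>Q)"
    using L(2) by (intro Bochner_Integration.integral_cong) (auto simp: MAP_rule_def max_post_def)
  then show "1 - (\<integral>y. max_post y \<partial>Q)
      \<in> (\<lambda>L. measure P {z \<in> space P. fst z \<noteq> L (snd z)}) ` (N \<rightarrow>\<^sub>M count_space X)"
    using error_prob(2)[OF L(1)] L(1) by force
next
  fix e assume "e \<in> (\<lambda>L. measure P {z \<in> space P. fst z \<noteq> L (snd z)}) ` (N \<rightarrow>\<^sub>M count_space X)"
  then obtain L where L: "L \<in> N \<rightarrow>\<^sub>M count_space X"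
    and e: "e = measure P {z \<in> space P. fst z \<noteq> L (snd z)}" by blast
  have "(\<integral>y. pmf (K y) (L y) \<partial>Q) \<le> (\<integral>y. max_post y \<partial>Q)"
    using measurable_space[OF L]
    by (intro integral_mono error_prob(1)[OF L] integrable_max_post pmf_le_max_post) auto
  then show "1 - (\<integral>y. max_post y \<partial>Q) \<le> e" using e error_prob(2)[OF L] by simp
qed

lemma min_error_prob_bounds: "0 \<le> min_error_prob X N P" "min_error_prob X N P \<le> 1 - 1 / card X"
proof -
  show "0 \<le> min_error_prob X N P"
    using integral_mono[OF integrable_max_post, of "\<lambda>_. 1"] max_post_bounds Y.prob_space
    by (simp add: min_error_prob_eq)
  show "min_error_prob X N P \<le> 1 - 1 / card X"
    using integral_mono[OF _ integrable_max_post, of "\<lambda>_. 1 / card X"] max_post_ge Y.prob_space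
    by (simp add: min_error_prob_eq)
qed

section \<open>The flat comparison distribution and its entropy\<close>

text \<open>Weights away from \<open>l\<close> enter only through their total. With \<open>l\<close>
  the MAP guess and \<open>f\<close> the posterior, a sum with two-valued coefficients becomes
  affine in the posterior maximum.\<close>

lemma sum_mult_if_eq:
  fixes f :: "'x \<Rightarrow> real"
  assumes "l \<in> X"
  shows "(\<Sum>x\<in>X. f x * (if x = l then u else v)) = f l * u + (sum f X - f l) * v"
proof -
  have "(\<Sum>x\<in>X. f x * (if x = l then u else v))
      = (\<Sum>x\<in>X. f x * v + (if x = l then f x * (u - v) else 0))"
    by (intro sum.cong) (auto simp: algebra_simps)
  also have "\<dots> = sum f X * v + f l * (u - v)"
    using X assms by (simp add: sum.distrib sum_distrib_right)
  finally show ?thesis by (simp add: algebra_simps)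
qed

lemma sum_if_eq:
  fixes u v :: real
  assumes "l \<in> X"
  shows "(\<Sum>x\<in>X. if x = l then u else v) = u + (real (card X) - 1) * v"
  using sum_mult_if_eq[OF assms, of "\<lambda>_. 1" u v] by simp

text \<open>The extremal distribution of the equality case, with \<open>l\<close> in the role of the
  MAP guess. If \<open>X\<close> is a singleton, the quotient by 0 is never selected for
  \<open>l\<close> and \<open>x\<close> in \<open>X\<close>.\<close>

definition flat_posterior :: "'x \<Rightarrow> 'x \<Rightarrow> real" where
  "flat_posterior l x =
     (if x = l then 1 - min_error_prob X N P else min_error_prob X N P / (real (card X) - 1))"

text \<open>The entropy of order \<alpha> of \<open>flat_posterior l\<close>, which is the same for
  every \<open>l\<close> in \<open>X\<close>. Its form matches
  \<open>log_minus_binary_renyi_div\<close>.\<close>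

definition flat_entropy :: "real \<Rightarrow> real \<Rightarrow> real" where
  "flat_entropy b \<alpha> = (let e = min_error_prob X N P; c = e / (real (card X) - 1) in
     if \<alpha> = 1 then - ((1 - e) * log b (1 - e) + (real (card X) - 1) * (c * log b c))
     else 1 / (1 - \<alpha>) * log b ((1 - e) powr \<alpha> + (real (card X) - 1) * c powr \<alpha>))"

lemma card_X: "card X \<ge> 1"
  using X X_nonempty by (simp add: Suc_le_eq card_gt_0_iff)

lemma min_error_prob_less_1: "min_error_prob X N P < 1"
proof -
  have "1 / real (card X) > 0" using card_X by simp
  then show ?thesis using min_error_prob_bounds(2) by linarith
qed

lemma sum_flat_posterior_powr:
  assumes "l \<in> X"
  shows "(\<Sum>x\<in>X. flat_posterior l x powr \<alpha>) = (1 - min_error_prob X N P) powr \<alpha>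
    + (real (card X) - 1) * (min_error_prob X N P / (real (card X) - 1)) powr \<alpha>"
  unfolding flat_posterior_def if_distrib[of "\<lambda>t. t powr \<alpha>"] by (rule sum_if_eq[OF assms])

text \<open>Sufficiency in the equality criterion: the integrand is almost everywhere a constant
  that does not depend on the guessed value, and the exponent \<open>1 / \<alpha>\<close> cancels
  the prefactor \<alpha>.\<close>

lemma arimoto_renyi_entropy_flat:
  assumes \<alpha>: "\<alpha> > 0" and L: "MAP_rule X N K L"
    and flat: "AE y in Q. \<forall>x\<in>X. pmf (K y) x = flat_posterior (L y) x"
  shows "arimoto_renyi_entropy b \<alpha> X N P K = flat_entropy b \<alpha>"
proof -
  have ae: "AE y in Q. y \<in> space N" using AE_space[of Q] by simp
  have LX: "L y \<in> X" if "y \<in> space N" for y using L that by (auto simp: MAP_rule_def)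
  define e where "e = min_error_prob X N P"
  define c where "c = e / (real (card X) - 1)"
  show ?thesis
  proof (cases "\<alpha> = 1")
    case True
    define u where "u = - ((1 - e) * log b (1 - e) + (real (card X) - 1) * (c * log b c))"
    have "(\<integral>y. (- (\<Sum>x\<in>X. pmf (K y) x * log b (pmf (K y) x))) \<partial>Q) = (\<integral>y. u \<partial>Q)"
    proof (rule integral_cong_AE)
      show "AE y in Q. - (\<Sum>x\<in>X. pmf (K y) x * log b (pmf (K y) x)) = u"
        using flat ae
      proof eventually_elim
        case (elim y)
        have "(\<Sum>x\<in>X. pmf (K y) x * log b (pmf (K y) x))
            = (\<Sum>x\<in>X. if x = L y then (1 - e) * log b (1 - e) else c * log b c)"
          using elim by (intro sum.cong) (auto simp: flat_posterior_def e_def c_def)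
        then show ?case using sum_if_eq[OF LX] elim by (simp add: u_def)
      qed
    qed auto
    then show ?thesis
      using True Y.prob_space
      by (simp add: arimoto_renyi_entropy_def flat_entropy_def u_def e_def c_def Let_def)
  next
    case False
    define S where "S = (1 - e) powr \<alpha> + (real (card X) - 1) * c powr \<alpha>"
    have "(\<integral>y. (\<Sum>x\<in>X. pmf (K y) x powr \<alpha>) powr (1 / \<alpha>) \<partial>Q) = (\<integral>y. S powr (1 / \<alpha>) \<partial>Q)"
    proof (rule integral_cong_AE)
      show "AE y in Q. (\<Sum>x\<in>X. pmf (K y) x powr \<alpha>) powr (1 / \<alpha>) = S powr (1 / \<alpha>)"
        using flat ae
      proof eventually_elim
        case (elim y)
        then show ?case
          using sum_flat_posterior_powr[OF LX[of y], of \<alpha>] by (simp add: S_def e_def c_def)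
      qed
    qed auto
    then show ?thesis
      using False \<alpha> Y.prob_space
      by (simp add: arimoto_renyi_entropy_def flat_entropy_def S_def e_def c_def Let_def log_powr)
  qed
qed

text \<open>The posterior maximum is at most 1 and has expectation 1, hence equals 1 almost
  everywhere and leaves no mass for other values.\<close>

lemma flat_of_min_error_prob_0:
  assumes L: "MAP_rule X N K L" and "min_error_prob X N P = 0"
  shows "AE y in Q. \<forall>x\<in>X. pmf (K y) x = flat_posterior (L y) x"
proof -
  have "AE y in Q. max_post y = 1"
    using assms(2) max_post_bounds integrable_max_post Y.prob_space
    by (intro Y.integral_eq_imp_AE_eq) (auto simp: min_error_prob_eq)
  moreover have "AE y in Q. y \<in> space N" using AE_space[of Q] by simp
  ultimately show ?thesis
  proof eventually_elim
    case (elim y)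
    then have LX: "L y \<in> X" and 1: "pmf (K y) (L y) = 1"
      using L by (auto simp: MAP_rule_def max_post_def)
    have "(\<Sum>x\<in>X - {L y}. pmf (K y) x) = 0"
      using sum_posterior[OF elim(2)] sum.remove[OF X LX, of "\<lambda>x. pmf (K y) x"] 1 by simp
    then have "\<forall>x\<in>X - {L y}. pmf (K y) x = 0"
      using X by (subst (asm) sum_nonneg_eq_0_iff) auto
    then show ?case using 1 assms(2) by (auto simp: flat_posterior_def)
  qed
qed

section \<open>The bound and its equality case for positive error probability\<close>

text \<open>Positive error probability gives \<open>flat_posterior\<close> full support, as
  \<open>Gibbs_gap\<close> and \<open>Hoelder_gap\<close> require of \<open>q\<close>. The second
  claim is the converse of \<open>arimoto_renyi_entropy_flat\<close>.\<close>

lemma arimoto_renyi_entropy_le_flat: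
  assumes b: "b > 1" and \<alpha>: "\<alpha> > 0" and L: "MAP_rule X N K L"
    and pos: "min_error_prob X N P > 0"
  shows "arimoto_renyi_entropy b \<alpha> X N P K \<le> flat_entropy b \<alpha>"
    and "arimoto_renyi_entropy b \<alpha> X N P K = flat_entropy b \<alpha> \<Longrightarrow>
      AE y in Q. \<forall>x\<in>X. pmf (K y) x = flat_posterior (L y) x"
proof -
  define m where "m = real (card X)"
  define e where "e = min_error_prob X N P"
  define c where "c = e / (m - 1)"
  have ae: "AE y in Q. y \<in> space N" using AE_space[of Q] by simp
  have LX: "L y \<in> X" "pmf (K y) (L y) = max_post y" if "y \<in> space N" for y
    using L that by (auto simp: MAP_rule_def max_post_def)
  have e: "0 < e" "e < 1" using pos min_error_prob_less_1 by (auto simp: e_def)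
  have "card X \<noteq> 1" using pos min_error_prob_bounds(2) by auto
  then have m: "m \<ge> 2" using card_X by (simp add: m_def)
  then have c: "c > 0" "(m - 1) * c = e" using e by (auto simp: c_def)
  have Emax: "(\<integral>y. max_post y \<partial>Q) = 1 - e" by (simp add: e_def min_error_prob_eq)
  have affine: "integrable Q (\<lambda>y. max_post y * u + (1 - max_post y) * v)"
    "(\<integral>y. max_post y * u + (1 - max_post y) * v \<partial>Q) = (1 - e) * u + e * v" for u v
    using integrable_max_post Y.prob_space by (auto simp: algebra_simps Emax)
  have flat: "flat_posterior l x = (if x = l then 1 - e else c)" for l x
    by (simp add: flat_posterior_def e_def c_def m_def)
  have flat_pos: "flat_posterior l x > 0" for l x using e c by (simp add: flat)
  have flat_sum: "(\<Sum>x\<in>X. flat_posterior l x) = 1" if "l \<in> X" for l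
    using sum_if_eq[OF that, of "1 - e" c] c by (simp add: flat m_def)
  \<comment> \<open>Used with \<open>f\<close> the logarithm for \<alpha> = 1 and with
    \<open>f t = t powr (\<alpha> - 1)\<close> otherwise: the linear functionals of the two gap
    lemmas.\<close>
  have sum_post: "(\<Sum>x\<in>X. pmf (K y) x * f (flat_posterior (L y) x))
      = max_post y * f (1 - e) + (1 - max_post y) * f c" if "y \<in> space N" for y and f :: "real \<Rightarrow> real"
    using sum_mult_if_eq[OF LX(1)[OF that], of "\<lambda>x. pmf (K y) x" "f (1 - e)" "f c"]
      sum_posterior[OF that] LX(2)[OF that] by (simp add: flat if_distrib[of f])
  have "arimoto_renyi_entropy b \<alpha> X N P K \<le> flat_entropy b \<alpha> \<and>
    (arimoto_renyi_entropy b \<alpha> X N P K = flat_entropy b \<alpha> \<longrightarrow>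
      (AE y in Q. \<forall>x\<in>X. pmf (K y) x = flat_posterior (L y) x))"
  proof (cases "\<alpha> = 1")
    case True
    \<comment> \<open>\<open>F y\<close> is the cross entropy of the posterior at \<open>y\<close>
      relative to the flat one, and \<open>G y\<close> is the posterior's own entropy. Being affine
      in \<open>max_post y\<close>, \<open>F\<close> has the flat entropy as its
      expectation.\<close>
    define F where "F y = max_post y * - log b (1 - e) + (1 - max_post y) * - log b c" for y
    define G where "G y = - (\<Sum>x\<in>X. pmf (K y) x * log b (pmf (K y) x))" for y
    have "(m - 1) * (c * log b c) = e * log b c" unfolding c(2)[symmetric] by simp
    then have h: "flat_entropy b \<alpha> = (1 - e) * - log b (1 - e) + e * - log b c"
      using True by (simp add: flat_entropy_def Let_def m_def c_def e_def)
    have F: "integrable Q F" "(\<integral>y. F y \<partial>Q) = flat_entropy b \<alpha>"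
      unfolding F_def h by (rule affine)+
    have gap: "G y \<le> F y" "G y = F y \<Longrightarrow> \<forall>x\<in>X. pmf (K y) x = flat_posterior (L y) x"
      if y: "y \<in> space N" for y
    proof -
      note Gibbs = Gibbs_gap[OF b X, of "\<lambda>x. pmf (K y) x" "flat_posterior (L y)",
          OF pmf_nonneg sum_posterior[OF y] flat_pos flat_sum[OF LX(1)[OF y]],
          unfolded sum_post[OF y, of "log b"]]
      show "G y \<le> F y" using Gibbs(1) by (simp add: F_def G_def)
      show "\<forall>x\<in>X. pmf (K y) x = flat_posterior (L y) x" if "G y = F y"
        using Gibbs(2) that by (simp add: F_def G_def)
    qed
    have "pmf (K y) x * log b (pmf (K y) x) \<le> 0" for x y
      using b pmf_le_1[of "K y" x] by (cases "pmf (K y) x = 0") (auto intro!: mult_nonneg_nonpos)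
    then have G0: "0 \<le> G y" for y unfolding G_def by (simp add: sum_nonpos)
    have G: "integrable Q G"
    proof (rule Bochner_Integration.integrable_bound[OF F(1)])
      show "G \<in> borel_measurable Q" unfolding G_def by measurable
      show "AE y in Q. norm (G y) \<le> norm (F y)"
        using ae by eventually_elim (use gap(1) G0 in \<open>fastforce simp: abs_of_nonneg\<close>)
    qed
    have H: "arimoto_renyi_entropy b \<alpha> X N P K = (\<integral>y. G y \<partial>Q)"
      using True by (simp add: arimoto_renyi_entropy_def G_def)
    have le: "AE y in Q. G y \<le> F y" using ae by eventually_elim (rule gap)
    have "(\<integral>y. G y \<partial>Q) \<le> (\<integral>y. F y \<partial>Q)" by (rule integral_mono_AE[OF G F(1) le])
    moreover have "AE y in Q. \<forall>x\<in>X. pmf (K y) x = flat_posterior (L y) x"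
      if "(\<integral>y. G y \<partial>Q) = (\<integral>y. F y \<partial>Q)"
      using Y.integral_eq_imp_AE_eq[OF G F(1) le that] ae by eventually_elim (rule gap)
    ultimately show ?thesis unfolding H F(2)[symmetric] by blast
  next
    case False
    define S where "S = (1 - e) powr \<alpha> + (m - 1) * c powr \<alpha>"
    define T where "T y = (\<Sum>x\<in>X. pmf (K y) x powr \<alpha>) powr (1 / \<alpha>)" for y
    \<comment> \<open>\<open>U y\<close> is the Hoelder bound for the norm \<open>T y\<close>. Its
      expectation is \<open>S powr (1 / \<alpha>)\<close>, the \<alpha>-norm of the flat
      distribution.\<close>
    define U where "U y = S powr (1 / \<alpha> - 1) *
      (max_post y * (1 - e) powr (\<alpha> - 1) + (1 - max_post y) * c powr (\<alpha> - 1))" for y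
    have S: "S > 0" unfolding S_def using e m by (intro add_pos_nonneg) auto
    have S_eq: "(1 - e) * (1 - e) powr (\<alpha> - 1) + e * c powr (\<alpha> - 1) = S"
      using e c unfolding S_def c(2)[symmetric] by (simp add: powr_diff)
    have U: "integrable Q U" unfolding U_def by (intro integrable_mult_right affine)
    have "(\<integral>y. U y \<partial>Q) = S powr (1 / \<alpha> - 1) * S"
      unfolding U_def integral_mult_right_zero affine S_eq ..
    then have EU: "(\<integral>y. U y \<partial>Q) = S powr (1 / \<alpha>)"
      using S powr_add[of S "1 / \<alpha> - 1" 1] by simp
    have T0: "0 \<le> T y" for y by (simp add: T_def)
    have T_le: "T y \<le> m powr (1 / \<alpha>)" for y
    proof -
      have "(\<Sum>x\<in>X. pmf (K y) x powr \<alpha>) \<le> m"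
        using sum_bounded_above[of X "\<lambda>x. pmf (K y) x powr \<alpha>" 1] \<alpha>
        by (simp add: m_def powr_le1 pmf_le_1)
      then show ?thesis unfolding T_def using \<alpha> by (intro powr_mono2) (auto intro: sum_nonneg)
    qed
    \<comment> \<open>The \<alpha>-norm dominates the maximum. Hence its expectation
      \<open>E\<close> is at least \<open>1 - e > 0\<close>, and taking logarithms is
      legitimate.\<close>
    have T_ge: "max_post y \<le> T y" for y
    proof -
      obtain x where x: "x \<in> X" "pmf (K y) x = max_post y" using max_post_attained by blast
      then have "max_post y powr \<alpha> \<le> (\<Sum>x\<in>X. pmf (K y) x powr \<alpha>)"
        using member_le_sum[of x X "\<lambda>x. pmf (K y) x powr \<alpha>"] X by simp
      then have "(max_post y powr \<alpha>) powr (1 / \<alpha>) \<le> T y"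
        unfolding T_def using \<alpha> by (intro powr_mono2) auto
      then show ?thesis using max_post_bounds(1)[of y] \<alpha> by (simp add: powr_powr)
    qed
    have T: "integrable Q T"
    proof (rule Y.integrable_const_bound[where B = "m powr (1 / \<alpha>)"])
      show "T \<in> borel_measurable Q" unfolding T_def by measurable
    qed (use T0 T_le in auto)
    define E where "E = (\<integral>y. T y \<partial>Q)"
    have "1 - e \<le> E"
      unfolding E_def Emax[symmetric] by (intro integral_mono integrable_max_post T T_ge)
    then have E: "E > 0" using e by simp
    have gap: "U y / (\<alpha> - 1) \<le> T y / (\<alpha> - 1)"
      "U y / (\<alpha> - 1) = T y / (\<alpha> - 1) \<Longrightarrow> \<forall>x\<in>X. pmf (K y) x = flat_posterior (L y) x"
      if y: "y \<in> space N" for y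
    proof -
      have S_eq: "(\<Sum>x\<in>X. flat_posterior (L y) x powr \<alpha>) = S"
        using sum_flat_posterior_powr[OF LX(1)[OF y]] by (simp add: S_def e_def c_def m_def)
      note Hoelder = Hoelder_gap[OF X \<alpha> False, of "\<lambda>x. pmf (K y) x" "flat_posterior (L y)",
          OF pmf_nonneg sum_posterior[OF y] flat_pos flat_sum[OF LX(1)[OF y]],
          unfolded sum_post[OF y, of "\<lambda>t. t powr (\<alpha> - 1)"] S_eq,
          folded T_def U_def]
      show "U y / (\<alpha> - 1) \<le> T y / (\<alpha> - 1)" using Hoelder(1) by (simp add: diff_divide_distrib)
      show "\<forall>x\<in>X. pmf (K y) x = flat_posterior (L y) x" if "U y / (\<alpha> - 1) = T y / (\<alpha> - 1)"
        using Hoelder(2) that by (simp add: diff_divide_distrib)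
    qed
    have le: "AE y in Q. U y / (\<alpha> - 1) \<le> T y / (\<alpha> - 1)" using ae by eventually_elim (rule gap)
    have int: "integrable Q (\<lambda>y. U y / (\<alpha> - 1))" "integrable Q (\<lambda>y. T y / (\<alpha> - 1))"
      using T U by auto
    have "S powr (1 / \<alpha>) / (\<alpha> - 1) \<le> E / (\<alpha> - 1)"
      using integral_mono_AE[OF int le] EU by (simp add: E_def)
    \<comment> \<open>For \<alpha> > 1 the negative prefactor reverses the inequality between
      \<open>S powr (1 / \<alpha>)\<close> and \<open>E\<close>; for \<alpha> < 1 the negative
      divisor \<open>\<alpha> - 1\<close> has already done so.\<close>
    then have "\<alpha> / (1 - \<alpha>) * log b E \<le> \<alpha> / (1 - \<alpha>) * log b (S powr (1 / \<alpha>))"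
    proof (cases "\<alpha> > 1")
      case True
      assume "S powr (1 / \<alpha>) / (\<alpha> - 1) \<le> E / (\<alpha> - 1)"
      then have "S powr (1 / \<alpha>) \<le> E" using True by (simp add: divide_le_cancel)
      then have "log b (S powr (1 / \<alpha>)) \<le> log b E" using b S E by simp
      then show ?thesis using True by (intro mult_left_mono_neg) (auto simp: divide_nonneg_neg)
    next
      case 2: False
      assume "S powr (1 / \<alpha>) / (\<alpha> - 1) \<le> E / (\<alpha> - 1)"
      then have "E \<le> S powr (1 / \<alpha>)" using 2 False by (simp add: divide_le_cancel)
      then have "log b E \<le> log b (S powr (1 / \<alpha>))" using b S E by simp
      then show ?thesis using 2 \<alpha> by (intro mult_left_mono) auto
    qed
    moreover have H: "arimoto_renyi_entropy b \<alpha> X N P K = \<alpha> / (1 - \<alpha>) * log b E"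
      using False by (simp add: arimoto_renyi_entropy_def E_def T_def)
    moreover have h: "flat_entropy b \<alpha> = \<alpha> / (1 - \<alpha>) * log b (S powr (1 / \<alpha>))"
      using False \<alpha> by (simp add: flat_entropy_def Let_def S_def c_def e_def m_def log_powr)
    moreover have "AE y in Q. \<forall>x\<in>X. pmf (K y) x = flat_posterior (L y) x"
      if "arimoto_renyi_entropy b \<alpha> X N P K = flat_entropy b \<alpha>"
    proof -
      have "log b E = log b (S powr (1 / \<alpha>))" using that False \<alpha> unfolding H h by simp
      then have "E = S powr (1 / \<alpha>)" using b E S inj_onD[OF log_inj[OF b]] by simp
      then have "(\<integral>y. U y / (\<alpha> - 1) \<partial>Q) = (\<integral>y. T y / (\<alpha> - 1) \<partial>Q)" using EU by (simp add: E_def)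
      from Y.integral_eq_imp_AE_eq[OF int le this] ae show ?thesis
        by eventually_elim (rule gap)
    qed
    ultimately show ?thesis by auto
  qed
  then show "arimoto_renyi_entropy b \<alpha> X N P K \<le> flat_entropy b \<alpha>"
    and "arimoto_renyi_entropy b \<alpha> X N P K = flat_entropy b \<alpha> \<Longrightarrow>
      AE y in Q. \<forall>x\<in>X. pmf (K y) x = flat_posterior (L y) x" by blast+
qed

end

section \<open>The bound for all error probabilities\<close>

theorem theorem3:
  fixes b \<alpha> :: real and X :: "'x set" and M :: nat
    and N :: "'y measure" and P :: "('x \<times> 'y) measure" and K :: "'y \<Rightarrow> 'x pmf"
  assumes "b > 1"
    and "finite X" and "card X = M"
    and "prob_space P" and "sets P = sets (count_space X \<Otimes>\<^sub>M N)"
    and "posterior X N P K"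
    and "\<alpha> > 0"
  shows "ereal (arimoto_renyi_entropy b \<alpha> X N P K)
           \<le> ereal (log b M) - binary_renyi_div b \<alpha> (min_error_prob X N P) (1 - 1 / M)
       \<and> (\<forall>L. MAP_rule X N K L \<longrightarrow>
           (ereal (arimoto_renyi_entropy b \<alpha> X N P K)
              = ereal (log b M) - binary_renyi_div b \<alpha> (min_error_prob X N P) (1 - 1 / M)
            \<longleftrightarrow>
            (AE y in marginal_Y N P. \<forall>x\<in>X.
               pmf (K y) x = (if x = L y then 1 - min_error_prob X N P
                              else min_error_prob X N P / (real M - 1)))))"
proof -
  interpret finite_guessing X N P K
    by (rule finite_guessing.intro) (use assms in auto)
  let ?e = "min_error_prob X N P"
  let ?H = "arimoto_renyi_entropy b \<alpha> X N P K"
  let ?A = "\<lambda>L. AE y in marginal_Y N P. \<forall>x\<in>X. pmf (K y) x = flat_posterior (L y) x"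
  \<comment> \<open>The right-hand side is finite, so the extended-real claims reduce to real
    ones.\<close>
  have rhs: "ereal (log b M) - binary_renyi_div b \<alpha> ?e (1 - 1 / M) = ereal (flat_entropy b \<alpha>)"
    using log_minus_binary_renyi_div[of b \<alpha> M ?e] assms card_X min_error_prob_bounds
    by (simp add: flat_entropy_def Let_def)
  have "?H \<le> flat_entropy b \<alpha> \<and> (?H = flat_entropy b \<alpha> \<longleftrightarrow> ?A L)" if L: "MAP_rule X N K L" for L
  proof (cases "?e = 0")
    case True
    then have "?A L" by (rule flat_of_min_error_prob_0[OF L])
    with arimoto_renyi_entropy_flat[OF \<open>\<alpha> > 0\<close> L this] show ?thesis by simp
  next
    case False
    then have "?e > 0" using min_error_prob_bounds(1) by simp
    then show ?thesis
      using arimoto_renyi_entropy_le_flat[OF \<open>b > 1\<close> \<open>\<alpha> > 0\<close> L]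
        arimoto_renyi_entropy_flat[OF \<open>\<alpha> > 0\<close> L] by blast
  qed
  \<comment> \<open>The inequality itself mentions no decision rule, so some MAP rule is needed to
    extract it from the previous step.\<close>
  moreover obtain L where "MAP_rule X N K L" using measurable_MAP_rule_exists by blast
  ultimately show ?thesis
    unfolding rhs by (simp add: flat_posterior_def \<open>card X = M\<close>)
qed

end
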